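(* Let $a,b\in\mathcal A_n$ be pure with $b\perp\mathrm{Lin}(e_0,a)$, and let $a$ alternate strongly with $b$. Put $\mathbb H_{a,b}=\mathrm{Lin}(e_0,a,b,ab)$. Then there exists a surjective homomorphism $\psi_{a,b}:\mathcal A_2\{-n(a),-n(b)\}\to\mathbb H_{a,b}$, and thus $\mathbb H_{a,b}$ is an associative subalgebra of $\mathcal A_n$.
   Context: Real Cayley–Dickson algebras: $\mathcal A_0=\mathbb R$ with trivial involution. Given nonzero reals $\gamma_0,\gamma_1,\dots$, the algebra $\mathcal A_{k+1}=\mathcal A_{k+1}\{\gamma_0,\dots,\gamma_k\}$ is $\mathcal A_k\times\mathcal A_k$ with componentwise addition and real scaling, product $(a,b)(c,d)=(ac+\gamma_k\bar d b,\ da+b\bar c)$ and involution $\overline{(a,b)}=(\bar a,-b)$. In the notation $\mathcal A_2\{-n(a),-n(b)\}$ (same construction with these two parameters) the parameters are allowed to be zero. Unity: $e_0$. $\mathrm{Re}(a)=\frac{a+\bar a}{2}$, $n(a)=a\bar a\in\mathbb R$, $\langle a,b\rangle=\frac12(a\bar b+b\bar a)$, and $\perp$ means orthogonality with respect to $\langle\cdot,\cdot\rangle$. An element $a$ is pure if $\mathrm{Re}(a)=0$. $\mathrm{Lin}$ is the real linear span. Elements $x,y$ alternate strongly if $(xx)y=x(xy)$ and $(yy)x=y(yx)$. *)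

theory Defs
  imports "HOL-Analysis.Finite_Function_Topology"
begin

text \<open>All algebras \<open>A\<^sub>n\<close> live on the one real vector space of finitely supported sequences
  \<open>nat \<Rightarrow>\<^sub>0 real\<close>: \<open>A\<^sub>n\<close> consists of the sequences supported on \<open>{..<2 ^ n}\<close>, and a pair
  \<open>(a, b)\<close> of elements of \<open>A\<^sub>n\<close> is coded by the concatenation of \<open>a\<close> and \<open>b\<close>. Addition, scaling
  and \<open>span\<close> are those of this type; its convolution product \<open>*\<close> plays no role.\<close>

type_synonym cd = "nat \<Rightarrow>\<^sub>0 real"

definition cd_carrier :: "nat \<Rightarrow> cd set" where
  "cd_carrier n = {x. Poly_Mapping.keys x \<subseteq> {..<2 ^ n}}"

lift_definition cd_pair :: "nat \<Rightarrow> cd \<Rightarrow> cd \<Rightarrow> cd" is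
  "\<lambda>n a b i. if i < 2 ^ n then a i else b (i - 2 ^ n)"
proof -
  fix n :: nat and a b :: "nat \<Rightarrow> real"
  assume fin: "finite {i. a i \<noteq> 0}" "finite {i. b i \<noteq> 0}"
  have "{i. (if i < 2 ^ n then a i else b (i - 2 ^ n)) \<noteq> 0}
          \<subseteq> {i. a i \<noteq> 0} \<union> (\<lambda>i. i + 2 ^ n) ` {i. b i \<noteq> 0}"
    by (auto simp: image_iff split: if_splits) (metis le_add_diff_inverse2 not_less)
  with fin show "finite {i. (if i < 2 ^ n then a i else b (i - 2 ^ n)) \<noteq> 0}"
    by (meson finite_UnI finite_imageI finite_subset)
qed

lift_definition cd_fst :: "nat \<Rightarrow> cd \<Rightarrow> cd" is
  "\<lambda>n x i. if i < 2 ^ n then x i else 0"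
  by (erule finite_subset [rotated]) auto

lift_definition cd_snd :: "nat \<Rightarrow> cd \<Rightarrow> cd" is
  "\<lambda>n x i. x (i + 2 ^ n)"
proof -
  fix n :: nat and x :: "nat \<Rightarrow> real"
  assume "finite {i. x i \<noteq> 0}"
  then have "finite ((\<lambda>i. i + 2 ^ n) -` {i. x i \<noteq> 0})"
    by (rule finite_vimageI) (simp add: inj_on_def)
  then show "finite {i. x (i + 2 ^ n) \<noteq> 0}" by (simp add: vimage_def)
qed

primrec cd_cnj :: "nat \<Rightarrow> cd \<Rightarrow> cd" where
  "cd_cnj 0 x = x"
| "cd_cnj (Suc n) x = cd_pair n (cd_cnj n (cd_fst n x)) (- cd_snd n x)"

text \<open>\<open>cd_mult \<gamma> n\<close> is the product of \<open>A\<^sub>n{\<gamma> 0, \<dots>, \<gamma> (n - 1)}\<close>; no condition is put on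
  \<open>\<gamma>\<close> here, so that zero parameters are allowed.\<close>

primrec cd_mult :: "(nat \<Rightarrow> real) \<Rightarrow> nat \<Rightarrow> cd \<Rightarrow> cd \<Rightarrow> cd" where
  "cd_mult \<gamma> 0 x y =
     Poly_Mapping.single 0 (Poly_Mapping.lookup x 0 * Poly_Mapping.lookup y 0)"
| "cd_mult \<gamma> (Suc n) x y =
     (let a = cd_fst n x; b = cd_snd n x; c = cd_fst n y; d = cd_snd n y in
      cd_pair n
        (cd_mult \<gamma> n a c + \<gamma> n *\<^sub>R cd_mult \<gamma> n (cd_cnj n d) b)
        (cd_mult \<gamma> n d a + cd_mult \<gamma> n b (cd_cnj n c)))"

definition cd_unit :: cd where
  "cd_unit = Poly_Mapping.single 0 1"

definition cd_Re :: "nat \<Rightarrow> cd \<Rightarrow> cd" where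
  "cd_Re n a = (1 / 2) *\<^sub>R (a + cd_cnj n a)"

definition cd_pure :: "nat \<Rightarrow> cd \<Rightarrow> bool" where
  "cd_pure n a \<longleftrightarrow> cd_Re n a = 0"

text \<open>The real number \<open>n(a)\<close> is the \<open>e\<^sub>0\<close>-coordinate of \<open>a * cnj a\<close>; lemma
  \<open>cd_mult_cnj_eq_norm\<close> below shows that this product is indeed \<open>n(a) e\<^sub>0\<close>.\<close>

definition cd_norm :: "(nat \<Rightarrow> real) \<Rightarrow> nat \<Rightarrow> cd \<Rightarrow> real" where
  "cd_norm \<gamma> n a = Poly_Mapping.lookup (cd_mult \<gamma> n a (cd_cnj n a)) 0"

text \<open>The bilinear form is left with values in \<open>A\<^sub>n\<close> (in fact, in \<open>\<real> e\<^sub>0\<close>).\<close>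

definition cd_inner :: "(nat \<Rightarrow> real) \<Rightarrow> nat \<Rightarrow> cd \<Rightarrow> cd \<Rightarrow> cd" where
  "cd_inner \<gamma> n a b =
     (1 / 2) *\<^sub>R (cd_mult \<gamma> n a (cd_cnj n b) + cd_mult \<gamma> n b (cd_cnj n a))"

definition cd_orthogonal_to :: "(nat \<Rightarrow> real) \<Rightarrow> nat \<Rightarrow> cd \<Rightarrow> cd set \<Rightarrow> bool" where
  "cd_orthogonal_to \<gamma> n b S \<longleftrightarrow> (\<forall>x\<in>S. cd_inner \<gamma> n b x = 0)"

definition cd_alternate_strongly :: "(nat \<Rightarrow> real) \<Rightarrow> nat \<Rightarrow> cd \<Rightarrow> cd \<Rightarrow> bool" where
  "cd_alternate_strongly \<gamma> n x y \<longleftrightarrow>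
     cd_mult \<gamma> n (cd_mult \<gamma> n x x) y = cd_mult \<gamma> n x (cd_mult \<gamma> n x y) \<and>
     cd_mult \<gamma> n (cd_mult \<gamma> n y y) x = cd_mult \<gamma> n y (cd_mult \<gamma> n y x)"

definition cd_H :: "(nat \<Rightarrow> real) \<Rightarrow> nat \<Rightarrow> cd \<Rightarrow> cd \<Rightarrow> cd set" where
  "cd_H \<gamma> n a b = span {cd_unit, a, b, cd_mult \<gamma> n a b}"

definition cd_subalgebra :: "(nat \<Rightarrow> real) \<Rightarrow> nat \<Rightarrow> cd set \<Rightarrow> bool" where
  "cd_subalgebra \<gamma> n H \<longleftrightarrow>
     H \<subseteq> cd_carrier n \<and> subspace H \<and> (\<forall>x\<in>H. \<forall>y\<in>H. cd_mult \<gamma> n x y \<in> H)"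

definition cd_associative_on :: "(nat \<Rightarrow> real) \<Rightarrow> nat \<Rightarrow> cd set \<Rightarrow> bool" where
  "cd_associative_on \<gamma> n H \<longleftrightarrow>
     (\<forall>x\<in>H. \<forall>y\<in>H. \<forall>z\<in>H.
        cd_mult \<gamma> n (cd_mult \<gamma> n x y) z = cd_mult \<gamma> n x (cd_mult \<gamma> n y z))"

text \<open>\<open>\<psi>\<close> is a homomorphism of real algebras from \<open>A\<^sub>m{\<delta> 0, \<dots>, \<delta> (m - 1)}\<close> onto the set \<open>H\<close>
  with the operations of \<open>A\<^sub>n{\<gamma> 0, \<dots>, \<gamma> (n - 1)}\<close>. The values of \<open>\<psi>\<close> outside \<open>A\<^sub>m\<close> are
  irrelevant.\<close>

definition cd_surj_hom ::
  "(nat \<Rightarrow> real) \<Rightarrow> nat \<Rightarrow> (nat \<Rightarrow> real) \<Rightarrow> nat \<Rightarrow> cd set \<Rightarrow> (cd \<Rightarrow> cd) \<Rightarrow> bool" where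
  "cd_surj_hom \<delta> m \<gamma> n H \<psi> \<longleftrightarrow>
     (\<forall>x\<in>cd_carrier m. \<forall>y\<in>cd_carrier m. \<psi> (x + y) = \<psi> x + \<psi> y) \<and>
     (\<forall>r. \<forall>x\<in>cd_carrier m. \<psi> (r *\<^sub>R x) = r *\<^sub>R \<psi> x) \<and>
     (\<forall>x\<in>cd_carrier m. \<forall>y\<in>cd_carrier m.
        \<psi> (cd_mult \<delta> m x y) = cd_mult \<gamma> n (\<psi> x) (\<psi> y)) \<and>
     \<psi> ` cd_carrier m = H"

text \<open>Two-parameter list \<open>{\<alpha>, \<beta>}\<close> for \<open>A\<^sub>2{\<alpha>, \<beta>}\<close>; later entries are not used by \<open>cd_mult _ 2\<close>.\<close>

definition cd_params2 :: "real \<Rightarrow> real \<Rightarrow> nat \<Rightarrow> real" where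
  "cd_params2 \<alpha> \<beta> k = (if k = 0 then \<alpha> else \<beta>)"


subsection \<open>The encoding agrees with the construction by pairs\<close>

lemma lookup_scaleR_cd [simp]:
  "Poly_Mapping.lookup (r *\<^sub>R x :: cd) i = r * Poly_Mapping.lookup x i"
proof -
  have "finite {i. r *\<^sub>R Poly_Mapping.lookup x i \<noteq> 0}"
    by (rule finite_subset [OF _ finite_lookup [of x]]) auto
  then show ?thesis by (simp add: scaleR_poly_mapping_def Abs_poly_mapping_inverse)
qed

lemma cd_carrier_iff: "x \<in> cd_carrier n \<longleftrightarrow> (\<forall>i\<ge>2 ^ n. Poly_Mapping.lookup x i = 0)"
  unfolding cd_carrier_def subset_iff mem_Collect_eq lessThan_iff in_keys_iff
  by (metis not_le)

lemma cd_fst_pair [simp]: "a \<in> cd_carrier n \<Longrightarrow> cd_fst n (cd_pair n a b) = a"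
  by (rule poly_mapping_eqI) (auto simp: cd_fst.rep_eq cd_pair.rep_eq cd_carrier_iff)

lemma cd_snd_pair [simp]: "cd_snd n (cd_pair n a b) = b"
  by (rule poly_mapping_eqI) (auto simp: cd_snd.rep_eq cd_pair.rep_eq)

lemma cd_fst_carrier [simp]: "cd_fst n x \<in> cd_carrier n"
  by (auto simp: cd_carrier_iff cd_fst.rep_eq)

lemma cd_snd_carrier [simp]: "x \<in> cd_carrier (Suc n) \<Longrightarrow> cd_snd n x \<in> cd_carrier n"
  by (auto simp: cd_carrier_iff cd_snd.rep_eq)

lemma cd_pair_carrier [simp]: "b \<in> cd_carrier n \<Longrightarrow> cd_pair n a b \<in> cd_carrier (Suc n)"
  by (auto simp: cd_carrier_iff cd_pair.rep_eq)

lemma cd_pair_fst_snd [simp]: "cd_pair n (cd_fst n x) (cd_snd n x) = x"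
  by (rule poly_mapping_eqI) (auto simp: cd_fst.rep_eq cd_snd.rep_eq cd_pair.rep_eq)

lemma cd_pair_add: "cd_pair n a b + cd_pair n c d = cd_pair n (a + c) (b + d)"
  by (rule poly_mapping_eqI) (auto simp: cd_pair.rep_eq lookup_add)

lemma cd_pair_scaleR: "r *\<^sub>R cd_pair n a b = cd_pair n (r *\<^sub>R a) (r *\<^sub>R b)"
  by (rule poly_mapping_eqI) (auto simp: cd_pair.rep_eq lookup_scaleR_cd)

lemma cd_pair_eqE:
  assumes "x \<in> cd_carrier (Suc n)"
  obtains a b where "a \<in> cd_carrier n" "b \<in> cd_carrier n" "x = cd_pair n a b"
  using assms by (metis cd_fst_carrier cd_snd_carrier cd_pair_fst_snd)

lemma cd_mult_pair:
  assumes "a \<in> cd_carrier n" "c \<in> cd_carrier n"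
  shows "cd_mult \<gamma> (Suc n) (cd_pair n a b) (cd_pair n c d) =
     cd_pair n (cd_mult \<gamma> n a c + \<gamma> n *\<^sub>R cd_mult \<gamma> n (cd_cnj n d) b)
               (cd_mult \<gamma> n d a + cd_mult \<gamma> n b (cd_cnj n c))"
  using assms by (simp add: Let_def)

lemma cd_cnj_pair:
  "a \<in> cd_carrier n \<Longrightarrow> cd_cnj (Suc n) (cd_pair n a b) = cd_pair n (cd_cnj n a) (- b)"
  by simp

lemma cd_carrier_subspace: "subspace (cd_carrier n)"
  by (auto simp: subspace_def cd_carrier_iff lookup_add lookup_scaleR_cd)

lemma cd_cnj_carrier [simp]: "a \<in> cd_carrier n \<Longrightarrow> cd_cnj n a \<in> cd_carrier n"
  by (induction n arbitrary: a) (simp_all add: subspace_neg [OF cd_carrier_subspace])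

lemma cd_cnj_cnj: "a \<in> cd_carrier n \<Longrightarrow> cd_cnj n (cd_cnj n a) = a"
  by (induction n arbitrary: a) simp_all

lemma cd_mult_carrier:
  assumes "x \<in> cd_carrier n" "y \<in> cd_carrier n"
  shows "cd_mult \<gamma> n x y \<in> cd_carrier n"
  using assms
proof (induction n arbitrary: x y)
  case 0
  then show ?case by (auto simp: cd_carrier_iff lookup_single)
next
  case (Suc n)
  then show ?case
    by (auto simp: Let_def intro!: cd_pair_carrier subspace_add [OF cd_carrier_subspace])
qed

lemma cd_fst_uminus: "cd_fst n (- x) = - cd_fst n x"
  by (rule poly_mapping_eqI) (simp add: cd_fst.rep_eq)

lemma cd_snd_uminus: "cd_snd n (- x) = - cd_snd n x"
  by (rule poly_mapping_eqI) (simp add: cd_snd.rep_eq)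

lemma cd_pair_uminus: "cd_pair n (- a) (- b) = - cd_pair n a b"
  by (rule poly_mapping_eqI) (simp add: cd_pair.rep_eq)

lemma cd_cnj_uminus: "cd_cnj n (- x) = - cd_cnj n x"
proof (induction n arbitrary: x)
  case (Suc n)
  then show ?case by (simp only: cd_cnj.simps cd_fst_uminus cd_snd_uminus cd_pair_uminus)
qed simp

lemma cd_mult_uminus:
  "cd_mult \<gamma> n (- x) y = - cd_mult \<gamma> n x y"  "cd_mult \<gamma> n x (- y) = - cd_mult \<gamma> n x y"
proof (induction n arbitrary: x y)
  case 0
  { case 1 show ?case by (simp add: single_uminus) }
  { case 2 show ?case by (simp add: single_uminus) }
next
  case (Suc n)
  { case 1 show ?case
      by (simp add: Let_def cd_fst_uminus cd_snd_uminus cd_cnj_uminus Suc flip: cd_pair_uminus) }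
  { case 2 show ?case
      by (simp add: Let_def cd_fst_uminus cd_snd_uminus cd_cnj_uminus Suc flip: cd_pair_uminus;
          rule arg_cong [OF minus_diff_commute]) }
qed

lemma cd_pair_unit: "cd_pair n (r *\<^sub>R cd_unit) 0 = r *\<^sub>R cd_unit"
  by (rule poly_mapping_eqI)
     (auto simp: cd_pair.rep_eq cd_unit_def lookup_single lookup_one when_def)

lemma cd_mult_cnj_scalar:
  assumes "a \<in> cd_carrier n"
  shows "\<exists>r. cd_mult \<gamma> n a (cd_cnj n a) = r *\<^sub>R cd_unit \<and> cd_mult \<gamma> n (cd_cnj n a) a = r *\<^sub>R cd_unit"
  using assms
proof (induction n arbitrary: a)
  case 0
  have "Poly_Mapping.single 0 s = s *\<^sub>R cd_unit" for s
    by (rule poly_mapping_eqI)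
       (auto simp: cd_unit_def lookup_single lookup_one when_def)
  then show ?case by auto
next
  case (Suc n)
  then obtain x y where xy: "x \<in> cd_carrier n" "y \<in> cd_carrier n" "a = cd_pair n x y"
    by (meson cd_pair_eqE)
  from Suc.IH [OF xy(1)] Suc.IH [OF xy(2)] obtain r s where rs:
    "cd_mult \<gamma> n x (cd_cnj n x) = r *\<^sub>R cd_unit" "cd_mult \<gamma> n (cd_cnj n x) x = r *\<^sub>R cd_unit"
    "cd_mult \<gamma> n y (cd_cnj n y) = s *\<^sub>R cd_unit" "cd_mult \<gamma> n (cd_cnj n y) y = s *\<^sub>R cd_unit"
    by metis
  have "cd_mult \<gamma> (Suc n) a (cd_cnj (Suc n) a) = (r - \<gamma> n * s) *\<^sub>R cd_unit \<and>
        cd_mult \<gamma> (Suc n) (cd_cnj (Suc n) a) a = (r - \<gamma> n * s) *\<^sub>R cd_unit"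
    using xy rs
    by (simp add: Let_def cd_cnj_cnj cd_cnj_uminus cd_mult_uminus cd_pair_unit
             flip: scaleR_diff_left)
  then show ?case by blast
qed

lemma cd_mult_cnj_eq_norm:
  assumes "a \<in> cd_carrier n"
  shows "cd_mult \<gamma> n a (cd_cnj n a) = cd_norm \<gamma> n a *\<^sub>R cd_unit"
  using cd_mult_cnj_scalar [OF assms, of \<gamma>]
  by (auto simp: cd_norm_def cd_unit_def lookup_scaleR_cd)

end

(* With c = ab, purity and orthogonality give ab = -ba, so conjugation turns the strong
   alternativity of a and b into the whole multiplication table of 1, a, b, c except for cc.
   As c is pure, cc is a scalar, and it is found from Re ((xy)z) = Re (x(yz)), which holds in every
   Cayley-Dickson algebra: Re ((ab)c) = Re (a(bc)). The table is that of A_2{-n(a), -n(b)}, which is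
   associative. *)

theory Submission
  imports Defs
begin

subsection \<open>Linearity, unit and conjugation in Cayley--Dickson algebras\<close>

lemma cd_fst_add: "cd_fst n (x + y) = cd_fst n x + cd_fst n y"
  by (rule poly_mapping_eqI) (simp add: cd_fst.rep_eq lookup_add)

lemma cd_snd_add: "cd_snd n (x + y) = cd_snd n x + cd_snd n y"
  by (rule poly_mapping_eqI) (simp add: cd_snd.rep_eq lookup_add)

lemma cd_fst_scaleR: "cd_fst n (r *\<^sub>R x) = r *\<^sub>R cd_fst n x"
  by (rule poly_mapping_eqI) (simp add: cd_fst.rep_eq)

lemma cd_snd_scaleR: "cd_snd n (r *\<^sub>R x) = r *\<^sub>R cd_snd n x"
  by (rule poly_mapping_eqI) (simp add: cd_snd.rep_eq)

lemma cd_cnj_add: "cd_cnj n (x + y) = cd_cnj n x + cd_cnj n y"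
  by (induction n arbitrary: x y) (simp_all add: cd_fst_add cd_snd_add cd_pair_add)

lemma cd_cnj_scaleR: "cd_cnj n (r *\<^sub>R x) = r *\<^sub>R cd_cnj n x"
  by (induction n arbitrary: x) (simp_all add: cd_fst_scaleR cd_snd_scaleR cd_pair_scaleR)

text \<open>The product at stage \<open>Suc n\<close> contains \<open>d a\<close> and
  \<open>cnj d b\<close>, where the factors have changed sides. Additivity in each argument
  therefore uses both statements at stage \<open>n\<close>, and the two are proved by one
  induction.\<close>

lemma cd_mult_add:
  "cd_mult \<gamma> n (x + x') y = cd_mult \<gamma> n x y + cd_mult \<gamma> n x' y"
  "cd_mult \<gamma> n x (y + y') = cd_mult \<gamma> n x y + cd_mult \<gamma> n x y'"
proof (induction n arbitrary: x x' y y')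
  case 0
  { case 1 show ?case by (simp add: lookup_add algebra_simps single_add) }
  { case 2 show ?case by (simp add: lookup_add algebra_simps single_add) }
next
  case (Suc n)
  { case 1 show ?case
      by (simp add: Let_def cd_fst_add cd_snd_add cd_pair_add cd_cnj_add Suc algebra_simps) }
  { case 2 show ?case
      by (simp add: Let_def cd_fst_add cd_snd_add cd_pair_add cd_cnj_add Suc algebra_simps) }
qed

lemma cd_mult_scaleR:
  "cd_mult \<gamma> n (r *\<^sub>R x) y = r *\<^sub>R cd_mult \<gamma> n x y"
  "cd_mult \<gamma> n x (r *\<^sub>R y) = r *\<^sub>R cd_mult \<gamma> n x y"
proof (induction n arbitrary: x y)
  case 0
  { case 1 show ?case by (rule poly_mapping_eqI) (simp add: lookup_single when_def) }
  { case 2 show ?case by (rule poly_mapping_eqI) (simp add: lookup_single when_def) }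
next
  case (Suc n)
  { case 1 show ?case
      by (simp add: Let_def cd_fst_scaleR cd_snd_scaleR cd_pair_scaleR cd_cnj_scaleR Suc
          algebra_simps) }
  { case 2 show ?case
      by (simp add: Let_def cd_fst_scaleR cd_snd_scaleR cd_pair_scaleR cd_cnj_scaleR Suc
          algebra_simps) }
qed

lemma cd_mult_zero [simp]: "cd_mult \<gamma> n 0 y = 0" "cd_mult \<gamma> n x 0 = 0"
  using cd_mult_scaleR(1) [of \<gamma> n 0 0 y] cd_mult_scaleR(2) [of \<gamma> n x 0 0] by simp_all

lemma cd_cnj_zero [simp]: "cd_cnj n 0 = 0"
  using cd_cnj_scaleR [of n 0] by simp

lemma cd_unit_carrier [simp]: "cd_unit \<in> cd_carrier n"
  by (auto simp: cd_carrier_iff cd_unit_def lookup_one when_def)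

lemma cd_unit_eq_pair: "cd_unit = cd_pair n cd_unit 0"
  using cd_pair_unit [of n 1] by simp

lemma cd_fst_unit [simp]: "cd_fst n cd_unit = cd_unit"
  by (subst (1) cd_unit_eq_pair [of n]) simp

lemma cd_snd_unit [simp]: "cd_snd n cd_unit = 0"
  by (subst cd_unit_eq_pair [of n]) simp

lemma cd_cnj_unit [simp]: "cd_cnj n cd_unit = cd_unit"
  by (induction n) (simp_all flip: cd_unit_eq_pair)

lemma cd_mult_unit [simp]:
  assumes "x \<in> cd_carrier n"
  shows "cd_mult \<gamma> n cd_unit x = x" "cd_mult \<gamma> n x cd_unit = x"
  using assms
proof (induction n arbitrary: x)
  case 0
  { case 1 then show ?case
      by (intro poly_mapping_eqI) (auto simp: cd_unit_def lookup_single when_def cd_carrier_iff) }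
  { case 2 then show ?case
      by (intro poly_mapping_eqI) (auto simp: cd_unit_def lookup_single when_def cd_carrier_iff) }
qed (simp_all add: Let_def)

lemma cd_cnj_mult:
  assumes "x \<in> cd_carrier n" "y \<in> cd_carrier n"
  shows "cd_cnj n (cd_mult \<gamma> n x y) = cd_mult \<gamma> n (cd_cnj n y) (cd_cnj n x)"
  using assms
proof (induction n arbitrary: x y)
  case 0
  then show ?case by (simp add: mult.commute)
next
  case (Suc n)
  obtain a b where x: "a \<in> cd_carrier n" "b \<in> cd_carrier n" "x = cd_pair n a b"
    using Suc.prems(1) by (rule cd_pair_eqE)
  obtain c d where y: "c \<in> cd_carrier n" "d \<in> cd_carrier n" "y = cd_pair n c d"
    using Suc.prems(2) by (rule cd_pair_eqE)
  \<comment> \<open>With this membership \<open>cd_fst_pair\<close> can read off the first component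
    of the product when its conjugate is unfolded.\<close>
  have "cd_mult \<gamma> n a c + \<gamma> n *\<^sub>R cd_mult \<gamma> n (cd_cnj n d) b \<in> cd_carrier n"
    using x y by (simp add: subspace_add subspace_scale cd_carrier_subspace cd_mult_carrier)
  then show ?case
    using x y
    by (simp add: Let_def Suc.IH cd_cnj_add cd_cnj_scaleR cd_cnj_uminus cd_mult_uminus cd_cnj_cnj)
qed

subsection \<open>The real part is an associative trace\<close>

text \<open>Coordinate 0 serves as the real part: at every stage it lies in the first component, and
  at stage 0 conjugation is the identity.\<close>

lemma lookup_cd_cnj_0 [simp]:
  "Poly_Mapping.lookup (cd_cnj n x) 0 = Poly_Mapping.lookup x 0"
  by (induction n arbitrary: x) (simp_all add: cd_pair.rep_eq cd_fst.rep_eq)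

lemma lookup_cd_mult_Suc_0:
  "Poly_Mapping.lookup (cd_mult \<gamma> (Suc n) x y) 0 =
     Poly_Mapping.lookup (cd_mult \<gamma> n (cd_fst n x) (cd_fst n y)) 0 +
     \<gamma> n * Poly_Mapping.lookup (cd_mult \<gamma> n (cd_cnj n (cd_snd n y)) (cd_snd n x)) 0"
  by (simp add: Let_def cd_pair.rep_eq lookup_add)

text \<open>In the recursion for coordinate 0, the first summand is symmetric by induction. In the
  second, \<open>cnj d b\<close> and \<open>cnj b d\<close> are conjugates of each other and so
  share coordinate 0.\<close>

lemma lookup_cd_mult_commute:
  assumes "x \<in> cd_carrier n" "y \<in> cd_carrier n"
  shows "Poly_Mapping.lookup (cd_mult \<gamma> n x y) 0 = Poly_Mapping.lookup (cd_mult \<gamma> n y x) 0"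
  using assms
proof (induction n arbitrary: x y)
  case (Suc n)
  have "Poly_Mapping.lookup (cd_mult \<gamma> n (cd_cnj n (cd_snd n y)) (cd_snd n x)) 0 =
        Poly_Mapping.lookup (cd_cnj n (cd_mult \<gamma> n (cd_cnj n (cd_snd n y)) (cd_snd n x))) 0"
    by simp
  also have "\<dots> = Poly_Mapping.lookup (cd_mult \<gamma> n (cd_cnj n (cd_snd n x)) (cd_snd n y)) 0"
    using Suc.prems by (simp add: cd_cnj_mult cd_cnj_cnj del: lookup_cd_cnj_0)
  finally show ?case
    unfolding lookup_cd_mult_Suc_0 using Suc.IH [of "cd_fst n x" "cd_fst n y"] by simp
qed (simp add: mult.commute)

text \<open>Expanding both bracketings in pairs gives four traces of triple products on each side.
  They agree up to rebracketing and cyclic rotation of the factors, and both are available one stage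
  lower.\<close>

lemma lookup_cd_mult_assoc:
  assumes "x \<in> cd_carrier n" "y \<in> cd_carrier n" "z \<in> cd_carrier n"
  shows "Poly_Mapping.lookup (cd_mult \<gamma> n (cd_mult \<gamma> n x y) z) 0 =
         Poly_Mapping.lookup (cd_mult \<gamma> n x (cd_mult \<gamma> n y z)) 0"
  using assms
proof (induction n arbitrary: x y z)
  case 0
  then show ?case by simp
next
  case (Suc n)
  obtain a b where x: "a \<in> cd_carrier n" "b \<in> cd_carrier n" "x = cd_pair n a b"
    using Suc.prems(1) by (rule cd_pair_eqE)
  obtain c d where y: "c \<in> cd_carrier n" "d \<in> cd_carrier n" "y = cd_pair n c d"
    using Suc.prems(2) by (rule cd_pair_eqE)
  obtain e f where z: "e \<in> cd_carrier n" "f \<in> cd_carrier n" "z = cd_pair n e f"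
    using Suc.prems(3) by (rule cd_pair_eqE)
  let ?t = "\<lambda>u. Poly_Mapping.lookup u 0" and ?m = "cd_mult \<gamma> n" and ?c = "cd_cnj n"
  note [simp] = cd_mult_carrier subspace_add [OF cd_carrier_subspace]
    subspace_scale [OF cd_carrier_subspace]
  \<comment> \<open>Each of the three facts is a cyclic rotation, obtained from the induction
    hypothesis and the symmetry of the trace.\<close>
  have 1: "?t (?m (?m (?c d) b) e) = ?t (?m (?m e (?c d)) b)"
    using x y z by (metis Suc.IH cd_cnj_carrier cd_mult_carrier lookup_cd_mult_commute)
  have 2: "?t (?m (?c f) (?m d a)) = ?t (?m a (?m (?c f) d))"
    using x y z by (metis Suc.IH cd_cnj_carrier cd_mult_carrier lookup_cd_mult_commute)
  have 3: "?t (?m (?c f) (?m b (?c c))) = ?t (?m (?m (?c c) (?c f)) b)"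
    using x y z by (metis Suc.IH cd_cnj_carrier cd_mult_carrier lookup_cd_mult_commute)
  have "?t (cd_mult \<gamma> (Suc n) (cd_mult \<gamma> (Suc n) x y) z) =
      ?t (?m (?m a c) e) + \<gamma> n * ?t (?m (?m (?c d) b) e)
      + \<gamma> n * (?t (?m (?c f) (?m d a)) + ?t (?m (?c f) (?m b (?c c))))"
    unfolding lookup_cd_mult_Suc_0 using x y z
    by (simp add: Let_def cd_mult_add cd_mult_scaleR lookup_add)
  also have "\<dots> = ?t (?m a (?m c e)) + \<gamma> n * ?t (?m a (?m (?c f) d))
      + \<gamma> n * (?t (?m (?m (?c c) (?c f)) b) + ?t (?m (?m e (?c d)) b))"
    unfolding 1 2 3 using x y z by (simp add: Suc.IH algebra_simps)
  also have "\<dots> = ?t (cd_mult \<gamma> (Suc n) x (cd_mult \<gamma> (Suc n) y z))"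
    unfolding lookup_cd_mult_Suc_0 using x y z
    by (simp add: Let_def cd_mult_add cd_mult_scaleR lookup_add cd_cnj_add cd_cnj_mult cd_cnj_cnj)
  finally show ?case .
qed

subsection \<open>Pure elements\<close>

lemma cd_pure_iff: "cd_pure n a \<longleftrightarrow> cd_cnj n a = - a"
  by (simp add: cd_pure_def cd_Re_def add_eq_0_iff)

lemma cd_mult_pure_self:
  assumes "a \<in> cd_carrier n" "cd_pure n a"
  shows "cd_mult \<gamma> n a a = - cd_norm \<gamma> n a *\<^sub>R cd_unit"
proof -
  have "- cd_mult \<gamma> n a a = cd_norm \<gamma> n a *\<^sub>R cd_unit"
    using cd_mult_cnj_eq_norm [OF assms(1), of \<gamma>] assms(2)
    by (simp add: cd_pure_iff cd_mult_uminus)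
  then have "cd_mult \<gamma> n a a = - (cd_norm \<gamma> n a *\<^sub>R cd_unit)"
    by (metis minus_minus)
  then show ?thesis by simp
qed

text \<open>In this form the square of a pure element is known as soon as its trace is; this is how
  the square of \<open>ab\<close> is found.\<close>

lemma cd_mult_pure_self_lookup:
  assumes "a \<in> cd_carrier n" "cd_pure n a"
  shows "cd_mult \<gamma> n a a = Poly_Mapping.lookup (cd_mult \<gamma> n a a) 0 *\<^sub>R cd_unit"
  by (simp add: cd_mult_pure_self [OF assms] cd_unit_def)

text \<open>For pure elements both conjugates in the bilinear form are negatives, so twice its value
  at \<open>b\<close> and \<open>a\<close> is \<open>- (ba + ab)\<close>.\<close>

lemma cd_mult_anticommute:
  assumes "cd_pure n a" "cd_pure n b" "cd_inner \<gamma> n b a = 0"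
  shows "cd_mult \<gamma> n b a = - cd_mult \<gamma> n a b"
proof -
  have "- cd_mult \<gamma> n b a - cd_mult \<gamma> n a b = 0"
    using assms by (simp add: cd_inner_def cd_pure_iff cd_mult_uminus)
  then have "- cd_mult \<gamma> n b a = cd_mult \<gamma> n a b" by simp
  then show ?thesis by (metis minus_minus)
qed

lemma cd_pure_mult:
  assumes "a \<in> cd_carrier n" "b \<in> cd_carrier n" "cd_pure n a" "cd_pure n b"
    and "cd_mult \<gamma> n b a = - cd_mult \<gamma> n a b"
  shows "cd_pure n (cd_mult \<gamma> n a b)"
  using assms by (simp add: cd_pure_iff cd_cnj_mult cd_mult_uminus)

text \<open>Conjugation reverses the product, and the two signs from purity cancel. This yields
  \<open>ca\<close> and \<open>cb\<close> from \<open>ac\<close> and \<open>bc\<close>.\<close>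

lemma cd_mult_swap_pure:
  assumes "x \<in> cd_carrier n" "y \<in> cd_carrier n" "cd_pure n x" "cd_pure n y"
  shows "cd_mult \<gamma> n y x = cd_cnj n (cd_mult \<gamma> n x y)"
  using assms by (simp add: cd_pure_iff cd_cnj_mult cd_mult_uminus)

subsection \<open>Coordinates in dimension four\<close>

text \<open>These are the structure constants of the generalized quaternion algebra with basis 1, i,
  j, ij, where i squares to \<open>\<delta> 0\<close> and j to \<open>\<delta> 1\<close>.\<close>

lemma lookup_cd_mult_2:
  fixes x y :: cd
  defines "X \<equiv> Poly_Mapping.lookup x" and "Y \<equiv> Poly_Mapping.lookup y"
  shows
    "Poly_Mapping.lookup (cd_mult \<delta> 2 x y) 0 =
       X 0 * Y 0 + \<delta> 0 * X 1 * Y 1 + \<delta> 1 * X 2 * Y 2 - \<delta> 0 * \<delta> 1 * X 3 * Y 3" (is ?L0)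
    "Poly_Mapping.lookup (cd_mult \<delta> 2 x y) 1 =
       X 0 * Y 1 + X 1 * Y 0 - \<delta> 1 * X 2 * Y 3 + \<delta> 1 * X 3 * Y 2" (is ?L1)
    "Poly_Mapping.lookup (cd_mult \<delta> 2 x y) 2 =
       X 0 * Y 2 + X 2 * Y 0 + \<delta> 0 * X 1 * Y 3 - \<delta> 0 * X 3 * Y 1" (is ?L2)
    "Poly_Mapping.lookup (cd_mult \<delta> 2 x y) 3 =
       X 0 * Y 3 + X 1 * Y 2 - X 2 * Y 1 + X 3 * Y 0" (is ?L3)
proof -
  note defs = X_def Y_def numeral_2_eq_2 numeral_3_eq_3 Let_def cd_pair.rep_eq cd_fst.rep_eq
    cd_snd.rep_eq lookup_add algebra_simps lookup_single when_def
  show ?L0 by (simp add: defs)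
  show ?L1 by (simp add: defs)
  show ?L2 by (simp add: defs)
  show ?L3 by (simp add: defs)
qed

lemma cd_carrier_2_eqI:
  assumes "x \<in> cd_carrier 2" "y \<in> cd_carrier 2"
    and "Poly_Mapping.lookup x 0 = Poly_Mapping.lookup y 0"
    and "Poly_Mapping.lookup x 1 = Poly_Mapping.lookup y 1"
    and "Poly_Mapping.lookup x 2 = Poly_Mapping.lookup y 2"
    and "Poly_Mapping.lookup x 3 = Poly_Mapping.lookup y 3"
  shows "x = y"
proof (rule poly_mapping_eqI)
  fix i :: nat
  consider "i = 0" | "i = 1" | "i = 2" | "i = 3" | "i \<ge> 4" by linarith
  then show "Poly_Mapping.lookup x i = Poly_Mapping.lookup y i"
    by cases (use assms in \<open>simp_all add: cd_carrier_iff\<close>)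
qed

text \<open>In each coordinate this is a polynomial identity, so it holds for all values of the
  parameters, zero included.\<close>

lemma cd_mult_2_assoc:
  assumes "x \<in> cd_carrier 2" "y \<in> cd_carrier 2" "z \<in> cd_carrier 2"
  shows "cd_mult \<delta> 2 (cd_mult \<delta> 2 x y) z = cd_mult \<delta> 2 x (cd_mult \<delta> 2 y z)"
  by (rule cd_carrier_2_eqI; (intro cd_mult_carrier assms)?; simp only: lookup_cd_mult_2; algebra)

text \<open>This is the map \<psi>, with \<open>c\<close> standing for the product of
  \<open>a\<close> and \<open>b\<close>. It need not be injective, since the four images of the
  basis may be linearly dependent.\<close>

definition quaternion_map :: "cd \<Rightarrow> cd \<Rightarrow> cd \<Rightarrow> cd \<Rightarrow> cd" where
  "quaternion_map a b c x =
     Poly_Mapping.lookup x 0 *\<^sub>R cd_unit + Poly_Mapping.lookup x 1 *\<^sub>R a +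
     Poly_Mapping.lookup x 2 *\<^sub>R b + Poly_Mapping.lookup x 3 *\<^sub>R c"

lemma quaternion_map_image:
  "quaternion_map a b c ` cd_carrier 2 = span {cd_unit, a, b, c}"
proof
  show "quaternion_map a b c ` cd_carrier 2 \<subseteq> span {cd_unit, a, b, c}"
    unfolding quaternion_map_def by (intro image_subsetI span_add span_scale span_base) simp_all
  show "span {cd_unit, a, b, c} \<subseteq> quaternion_map a b c ` cd_carrier 2"
  proof
    fix v assume "v \<in> span {cd_unit, a, b, c}"
    \<comment> \<open>Splitting off one generator at a time leaves a remainder in the span of the
      empty set, which is zero.\<close>
    then obtain p q r s where "v - p *\<^sub>R cd_unit - q *\<^sub>R a - r *\<^sub>R b - s *\<^sub>R c = 0"
      by (auto simp: span_breakdown_eq)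
    then have v: "v = p *\<^sub>R cd_unit + q *\<^sub>R a + r *\<^sub>R b + s *\<^sub>R c"
      by (simp add: algebra_simps)
    define x :: cd where
      "x = Poly_Mapping.single 0 p + Poly_Mapping.single 1 q + Poly_Mapping.single 2 r
         + Poly_Mapping.single 3 s"
    have "x \<in> cd_carrier 2"
      by (auto simp: x_def cd_carrier_iff lookup_add lookup_single when_def)
    moreover have "v = quaternion_map a b c x"
      by (simp add: v x_def quaternion_map_def lookup_add lookup_single)
    ultimately show "v \<in> quaternion_map a b c ` cd_carrier 2" by blast
  qed
qed

text \<open>Both sides are bilinear in \<open>x\<close> and \<open>y\<close>, so it suffices that
  the generators multiply as the basis of the quaternion algebra does.\<close>

lemma quaternion_map_mult:
  assumes "a \<in> cd_carrier n" "b \<in> cd_carrier n" "c \<in> cd_carrier n"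
    and "cd_mult \<gamma> n a a = \<alpha> *\<^sub>R cd_unit" "cd_mult \<gamma> n b b = \<beta> *\<^sub>R cd_unit"
    and "cd_mult \<gamma> n c c = (- \<alpha> * \<beta>) *\<^sub>R cd_unit"
    and "cd_mult \<gamma> n a b = c" "cd_mult \<gamma> n b a = - c"
    and "cd_mult \<gamma> n a c = \<alpha> *\<^sub>R b" "cd_mult \<gamma> n c a = - \<alpha> *\<^sub>R b"
    and "cd_mult \<gamma> n b c = - \<beta> *\<^sub>R a" "cd_mult \<gamma> n c b = \<beta> *\<^sub>R a"
  shows "quaternion_map a b c (cd_mult (cd_params2 \<alpha> \<beta>) 2 x y) =
         cd_mult \<gamma> n (quaternion_map a b c x) (quaternion_map a b c y)"
  unfolding quaternion_map_def lookup_cd_mult_2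
  by (simp add: cd_mult_add cd_mult_scaleR assms cd_params2_def)
     (simp add: algebra_simps scaleR_diff_left)

lemma quaternion_map_surj_hom:
  assumes "\<And>x y. quaternion_map a b c (cd_mult \<delta> 2 x y) =
             cd_mult \<gamma> n (quaternion_map a b c x) (quaternion_map a b c y)"
  shows "cd_surj_hom \<delta> 2 \<gamma> n (span {cd_unit, a, b, c}) (quaternion_map a b c)"
  unfolding cd_surj_hom_def
  by (auto simp: assms quaternion_map_image)
     (simp_all add: quaternion_map_def lookup_add algebra_simps)

section \<open>Transport of closure and associativity along a surjective homomorphism\<close>

lemma cd_surj_hom_closed:
  assumes "cd_surj_hom \<delta> m \<gamma> n H \<psi>" "x \<in> H" "y \<in> H"
  shows "cd_mult \<gamma> n x y \<in> H"
proof -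
  obtain x' y' where "x' \<in> cd_carrier m" "y' \<in> cd_carrier m" "x = \<psi> x'" "y = \<psi> y'"
    using assms by (auto simp: cd_surj_hom_def)
  then have "cd_mult \<gamma> n x y = \<psi> (cd_mult \<delta> m x' y')" "cd_mult \<delta> m x' y' \<in> cd_carrier m"
    using assms(1) by (simp_all add: cd_surj_hom_def cd_mult_carrier)
  then show ?thesis
    using assms(1) by (auto simp: cd_surj_hom_def)
qed

lemma cd_surj_hom_associative_on:
  assumes "cd_surj_hom \<delta> 2 \<gamma> n H \<psi>"
  shows "cd_associative_on \<gamma> n H"
  unfolding cd_associative_on_def
proof (intro ballI)
  fix x y z assume "x \<in> H" "y \<in> H" "z \<in> H"
  with assms obtain x' y' z' where "x' \<in> cd_carrier 2" "y' \<in> cd_carrier 2" "z' \<in> cd_carrier 2"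
    and "x = \<psi> x'" "y = \<psi> y'" "z = \<psi> z'"
    by (auto simp: cd_surj_hom_def)
  moreover have "\<psi> (cd_mult \<delta> 2 u v) = cd_mult \<gamma> n (\<psi> u) (\<psi> v)"
    if "u \<in> cd_carrier 2" "v \<in> cd_carrier 2" for u v
    using assms that by (simp add: cd_surj_hom_def)
  ultimately show "cd_mult \<gamma> n (cd_mult \<gamma> n x y) z = cd_mult \<gamma> n x (cd_mult \<gamma> n y z)"
    by (metis cd_mult_carrier cd_mult_2_assoc)
qed

section \<open>Multiplication table of the generators and conclusion\<close>

theorem lemma5p6:
  fixes \<gamma> :: "nat \<Rightarrow> real" and n :: nat and a b :: cd
  assumes "\<And>k. \<gamma> k \<noteq> 0"
    and "a \<in> cd_carrier n" and "b \<in> cd_carrier n"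
    and "cd_pure n a" and "cd_pure n b"
    and "cd_orthogonal_to \<gamma> n b (span {cd_unit, a})"
    and "cd_alternate_strongly \<gamma> n a b"
  shows "(\<exists>\<psi>. cd_surj_hom (cd_params2 (- cd_norm \<gamma> n a) (- cd_norm \<gamma> n b)) 2 \<gamma> n
                 (cd_H \<gamma> n a b) \<psi>) \<and>
         cd_subalgebra \<gamma> n (cd_H \<gamma> n a b) \<and>
         cd_associative_on \<gamma> n (cd_H \<gamma> n a b)"
proof -
  define \<alpha> \<beta> c where "\<alpha> = - cd_norm \<gamma> n a" and "\<beta> = - cd_norm \<gamma> n b" and "c = cd_mult \<gamma> n a b"
  note carr = assms(2,3) and pure = assms(4,5)
  have aa: "cd_mult \<gamma> n a a = \<alpha> *\<^sub>R cd_unit" and bb: "cd_mult \<gamma> n b b = \<beta> *\<^sub>R cd_unit"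
    using carr pure by (simp_all add: \<alpha>_def \<beta>_def cd_mult_pure_self)
  have "cd_inner \<gamma> n b a = 0"
    using assms(6) by (simp add: cd_orthogonal_to_def span_base)
  then have ba: "cd_mult \<gamma> n b a = - c"
    unfolding c_def using pure by (intro cd_mult_anticommute)
  have c: "c \<in> cd_carrier n" "cd_pure n c"
    using carr pure ba by (simp_all add: c_def cd_mult_carrier cd_pure_mult)
  \<comment> \<open>First half of strong alternativity: \<open>a(ab) = (aa)b\<close>.\<close>
  have ac: "cd_mult \<gamma> n a c = \<alpha> *\<^sub>R b"
    using assms(7) carr by (simp add: cd_alternate_strongly_def aa cd_mult_scaleR flip: c_def)
  \<comment> \<open>Second half: \<open>(bb)a = b(ba)\<close>, where
    \<open>ba = - c\<close>.\<close>
  have "\<beta> *\<^sub>R a = - cd_mult \<gamma> n b c"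
    using assms(7) carr
    by (simp add: cd_alternate_strongly_def bb ba cd_mult_scaleR cd_mult_uminus)
  then have bc: "cd_mult \<gamma> n b c = - \<beta> *\<^sub>R a"
    by simp
  have ca: "cd_mult \<gamma> n c a = - \<alpha> *\<^sub>R b"
    using cd_mult_swap_pure [OF carr(1) c(1) pure(1) c(2), of \<gamma>] pure
    by (simp add: ac cd_cnj_scaleR cd_pure_iff)
  have cb: "cd_mult \<gamma> n c b = \<beta> *\<^sub>R a"
    using cd_mult_swap_pure [OF carr(2) c(1) pure(2) c(2), of \<gamma>] pure
    by (simp add: bc cd_cnj_scaleR cd_cnj_uminus cd_pure_iff)
  \<comment> \<open>Trace associativity for \<open>a\<close>, \<open>b\<close>, \<open>c\<close>:
    the left bracketing is \<open>cc\<close>, and the right one is known because \<open>bc\<close>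
    is a multiple of \<open>a\<close> and \<open>aa\<close> is a scalar.\<close>
  have "Poly_Mapping.lookup (cd_mult \<gamma> n c c) 0 =
        Poly_Mapping.lookup (cd_mult \<gamma> n a (cd_mult \<gamma> n b c)) 0"
    using lookup_cd_mult_assoc [OF carr c(1), of \<gamma>] by (simp add: c_def)
  also have "\<dots> = - \<alpha> * \<beta>"
    unfolding bc by (simp only: cd_mult_scaleR aa) (simp add: cd_unit_def)
  finally have cc: "cd_mult \<gamma> n c c = (- \<alpha> * \<beta>) *\<^sub>R cd_unit"
    using cd_mult_pure_self_lookup [OF c, of \<gamma>] by simp
  have H: "cd_H \<gamma> n a b = span {cd_unit, a, b, c}"
    by (simp add: cd_H_def c_def)
  have hom: "cd_surj_hom (cd_params2 \<alpha> \<beta>) 2 \<gamma> n (cd_H \<gamma> n a b) (quaternion_map a b c)"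
    unfolding H
    by (intro quaternion_map_surj_hom quaternion_map_mult carr c(1) aa bb cc ba ac ca bc cb
        c_def [symmetric])
  have "cd_H \<gamma> n a b \<subseteq> cd_carrier n"
    unfolding H using carr c(1) by (intro span_minimal cd_carrier_subspace) auto
  then have "cd_subalgebra \<gamma> n (cd_H \<gamma> n a b)"
    using cd_surj_hom_closed [OF hom] by (simp add: cd_subalgebra_def H)
  with hom show ?thesis
    using cd_surj_hom_associative_on [OF hom] by (auto simp: \<alpha>_def \<beta>_def)
qed

end
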